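(* Let $S=[0,1]$ and let $\nu_0$ be the uniform distribution over $S$. Let $$I_1(u,\nu_0)=\inf_{\mu\in M_1(S)}\Big\{H(\nu_0|\mu):\int_0^1x\,\mu(dx)=u\Big\}.$$ Then $$I_1(u,\nu_0)=\int_0^1\log(\alpha+\beta x)\,\nu_0(dx)=F^{-1}(u)(u-1)+\log\big(1+F^{-1}(u)u\big),$$ where $$\alpha+\beta=\alpha e^{\beta},\qquad \alpha+\beta u=1,$$ and $$F(\lambda)=\begin{cases}\frac12,&\lambda=0,\\[2pt] \dfrac{e^\lambda}{e^\lambda-1}-\dfrac1\lambda,&\text{else}.\end{cases}$$
   Context: $M_1(S)$ is the space of Borel probability measures on $S=[0,1]$. The relative entropy of $\nu$ with respect to $\mu$ is $H(\nu|\mu)=\sup\{\langle\nu,g\rangle-\log\langle\mu,e^g\rangle:g\in C(S)\}$, where $\langle\nu,g\rangle=\int g\,d\nu$ and $C(S)$ is the space of continuous functions on $S$. $\log$ is the natural logarithm. $u$ is the argument of the function $I_1(\cdot,\nu_0)$, i.e. the prescribed value of the mean of $\mu$. $F^{-1}$ denotes the inverse function of $F$.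
   Formalization: Takes 0<u<1, where F^{-1}(u) is defined, and requires β≠0 when u≠1/2, because α=1, β=0 solves both equations for every u yet would give I_1=0, which is false unless u=1/2; the remaining solution is shown to exist and be unique. *)

theory Defs
  imports "HOL-Probability.Probability"
begin

definition prob_measures :: "'a::topological_space set \<Rightarrow> 'a measure set" where
  "prob_measures S = {\<mu>. prob_space \<mu> \<and> sets \<mu> = sets (restrict_space borel S)}"

text \<open>
  Elements of \<open>C(S)\<close> are represented by total functions that are continuous on \<open>S\<close>.  The measures
  in question have space \<open>S\<close>, so the values of \<open>g\<close> outside \<open>S\<close> do not affect the integrals.
\<close>

definition relative_entropy ::
    "'a::topological_space set \<Rightarrow> 'a measure \<Rightarrow> 'a measure \<Rightarrow> ereal" where
  "relative_entropy S \<nu> \<mu> =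
     (SUP g\<in>{g :: 'a \<Rightarrow> real. continuous_on S g}.
        ereal ((\<integral>x. g x \<partial>\<nu>) - ln (\<integral>x. exp (g x) \<partial>\<mu>)))"

definition uniform01 :: "real measure" where
  "uniform01 = uniform_measure (restrict_space lborel {0..1}) {0..1}"

definition I1 :: "real \<Rightarrow> real measure \<Rightarrow> ereal" where
  "I1 u \<nu> =
     (INF \<mu>\<in>{\<mu> \<in> prob_measures {0..1}. (\<integral>x. x \<partial>\<mu>) = u}. relative_entropy {0..1} \<nu> \<mu>)"

definition F :: "real \<Rightarrow> real" where
  "F t = (if t = 0 then 1 / 2 else exp t / (exp t - 1) - 1 / t)"

text \<open>
  For every \<open>u\<close> the pair \<open>\<alpha> = 1\<close>, \<open>\<beta> = 0\<close> solves both equations below.  It is the intended solution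
  only for \<open>u = 1/2\<close>, where \<open>1 / (\<alpha> + \<beta> x)\<close> is the density of a distribution with mean \<open>u\<close>;
  for other \<open>u\<close> this degenerate solution is excluded.
\<close>

definition multipliers :: "real \<Rightarrow> real \<Rightarrow> real \<Rightarrow> bool" where
  "multipliers u \<alpha> \<beta> \<longleftrightarrow>
     \<alpha> + \<beta> = \<alpha> * exp \<beta> \<and> \<alpha> + \<beta> * u = 1 \<and> (u \<noteq> 1 / 2 \<longrightarrow> \<beta> \<noteq> 0)"

end

theory Submission imports Defs "HOL-Real_Asymp.Real_Asymp" begin

text \<open>
  With \<open>h x = \<alpha> + \<beta> x\<close>, the test function \<open>g = ln h\<close> has \<open>\<integral>exp g d\<mu> = \<alpha> + \<beta> u = 1\<close> for every
  \<open>\<mu>\<close> with mean \<open>u\<close>, so \<open>\<integral>ln h d\<nu>\<^sub>0\<close> is a lower bound for the relative entropy.  The two equations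
  for \<open>\<alpha>\<close> and \<open>\<beta>\<close> say exactly that \<open>1 / h\<close> is the \<open>\<nu>\<^sub>0\<close>-density of a probability measure with mean
  \<open>u\<close>, and Jensen's inequality shows that this measure attains the bound.  Eliminating \<open>\<alpha>\<close> turns
  the equations into \<open>F (-\<beta>) = u\<close>.
\<close>

section \<open>The function \<open>F\<close>\<close>

text \<open>This reflection halves the later work: monotonicity is differentiated only on the
  nonnegative side, and facts near the value 1 transfer to the value 0.\<close>

lemma F_minus: "F (- t) = 1 - F t"
proof (cases "t = 0")
  case False
  have e: "exp t \<noteq> 1" using False by simp
  have "exp (- t) / (exp (- t) - 1) = - 1 / (exp t - 1)"
    using e by (simp add: exp_minus field_simps)
  moreover have "exp t / (exp t - 1) = 1 + 1 / (exp t - 1)"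
    using e by (simp add: field_simps)
  ultimately show ?thesis using False by (simp add: F_def)
qed (simp add: F_def)

lemma continuous_on_F: "continuous_on UNIV F"
proof -
  have "isCont F t" for t
  proof (cases "t = 0")
    case True
    have "((\<lambda>t::real. exp t / (exp t - 1) - 1 / t) \<longlongrightarrow> 1 / 2) (at 0)"
      by real_asymp
    then have "(F \<longlongrightarrow> 1 / 2) (at 0)"
      by (rule Lim_transform_eventually)
        (auto simp: F_def eventually_at_filter)
    then show ?thesis using True by (simp add: isCont_def F_def)
  next
    case False
    have "isCont (\<lambda>t. exp t / (exp t - 1) - 1 / t) t"
      using False by (intro continuous_intros) auto
    moreover have "\<forall>\<^sub>F s in nhds t. F s = exp s / (exp s - 1) - 1 / s"
      using t1_space_nhds[OF False] by eventually_elim (simp add: F_def)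
    ultimately show ?thesis using isCont_cong by fast
  qed
  then show ?thesis by (simp add: continuous_at_imp_continuous_on)
qed

text \<open>Positivity of the derivative of \<open>F\<close> on the positive half-line, with
  denominators cleared. After division by \<open>exp t\<close> and taking roots it reads
  \<open>t < 2 sinh (t / 2)\<close>.\<close>

lemma square_mult_exp_less:
  fixes t :: real
  assumes "0 < t"
  shows "t\<^sup>2 * exp t < (exp t - 1)\<^sup>2"
proof -
  define f where "f s = exp (s / 2) - exp (- s / 2) - s" for s :: real
  have "f 0 < f t"
  proof (rule DERIV_pos_imp_increasing_open[OF assms])
    fix s :: real assume s: "0 < s" "s < t"
    have "(f has_real_derivative exp (s / 2) / 2 + exp (- s / 2) / 2 - 1) (at s)"
      unfolding f_def by (auto intro!: derivative_eq_intros)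
    moreover have "exp (s / 2) / 2 + exp (- s / 2) / 2 - 1 > 0"
    proof -
      \<comment> \<open>The derivative is \<open>cosh (s / 2) - 1\<close>, which is half of this
        square.\<close>
      have "0 < (exp (s / 4) - exp (- s / 4))\<^sup>2" using s by simp
      also have "\<dots> = exp (s / 2) + exp (- s / 2) - 2"
        by (simp add: power2_diff flip: exp_double exp_add)
      finally show ?thesis by simp
    qed
    ultimately show "\<exists>y. (f has_real_derivative y) (at s) \<and> 0 < y" by blast
  qed (auto simp: f_def intro!: continuous_intros)
  then have "t < exp (t / 2) - exp (- t / 2)" by (simp add: f_def)
  then have "t * exp (t / 2) < (exp (t / 2) - exp (- t / 2)) * exp (t / 2)" by simp
  also have "\<dots> = exp t - 1" by (simp add: algebra_simps flip: exp_add)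
  finally have "(t * exp (t / 2))\<^sup>2 < (exp t - 1)\<^sup>2"
    using assms by (intro power_strict_mono) auto
  then show ?thesis by (simp add: power_mult_distrib flip: exp_double)
qed

text \<open>The derivative criterion asks for derivatives only in the open interval, so
  \<open>a = 0\<close>, where the formula for \<open>F\<close> changes, is covered by
  continuity.\<close>

lemma F_strict_mono_nonneg:
  assumes "0 \<le> a" "a < b"
  shows "F a < F b"
proof (rule DERIV_pos_imp_increasing_open[OF assms(2)])
  fix t assume t: "a < t" "t < b"
  then have t0: "t > 0" using assms by simp
  then have e: "exp t - 1 > 0" by simp
  have "((\<lambda>t. exp t / (exp t - 1) - 1 / t) has_real_derivative
      (1 / t\<^sup>2 - exp t / (exp t - 1)\<^sup>2)) (at t)"
    using t0 e by (auto intro!: derivative_eq_intros simp: field_simps power2_eq_square)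
  moreover have "\<forall>\<^sub>F s in nhds t. F s = exp s / (exp s - 1) - 1 / s"
    using t1_space_nhds[of t 0] t0 by (auto elim!: eventually_mono simp: F_def)
  ultimately have "(F has_real_derivative (1 / t\<^sup>2 - exp t / (exp t - 1)\<^sup>2)) (at t)"
    using DERIV_cong_ev by fast
  moreover have "1 / t\<^sup>2 - exp t / (exp t - 1)\<^sup>2 > 0"
    using square_mult_exp_less[OF t0] t0 e by (simp add: field_simps)
  ultimately show "\<exists>y. (F has_real_derivative y) (at t) \<and> 0 < y" by blast
qed (auto intro: continuous_on_subset[OF continuous_on_F])

lemma strict_mono_F: "strict_mono F"
proof (rule strict_monoI)
  fix a b :: real assume "a < b"
  consider "0 \<le> a" | "b \<le> 0" | "a < 0" "0 < b" by linarith
  then show "F a < F b"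
  proof cases
    case 1 then show ?thesis using \<open>a < b\<close> by (rule F_strict_mono_nonneg)
  next
    case 2
    then show ?thesis using F_strict_mono_nonneg[of "- b" "- a"] \<open>a < b\<close> by (simp add: F_minus)
  next
    case 3
    then show ?thesis
      using F_strict_mono_nonneg[of 0 "- a"] F_strict_mono_nonneg[of 0 b]
      by (simp add: F_minus F_def[of 0])
  qed
qed

text \<open>For positive arguments the bound amounts to \<open>s < exp s - 1\<close>, the
  exponential of \<open>ln (1 + s) < s\<close>. Any other argument lies below a positive one, and
  monotonicity applies.\<close>

lemma F_less_1: "F t < 1"
proof -
  have "F s < 1" if "s > 0" for s
  proof -
    have "s < exp s - 1"
      using exp_less_mono[OF ln_add_one_self_less_self[OF that]] that by simp
    then show ?thesis using that by (simp add: F_def field_simps)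
  qed
  then show ?thesis
    using strict_monoD[OF strict_mono_F, of t "max t 0 + 1"] by (smt (verit))
qed

text \<open>The limit 1 at infinity gives values above any \<open>u < 1\<close>, reflection gives
  values below any \<open>u > 0\<close>, and the intermediate value theorem fills the gap.\<close>

lemma bij_betw_F: "bij_betw F UNIV {0<..<1}"
proof -
  have top: "(F \<longlongrightarrow> 1) at_top"
  proof (rule Lim_transform_eventually)
    show "((\<lambda>t::real. exp t / (exp t - 1) - 1 / t) \<longlongrightarrow> 1) at_top" by real_asymp
    show "\<forall>\<^sub>F t in at_top. exp t / (exp t - 1) - 1 / t = F t"
      using eventually_gt_at_top[of 0] by eventually_elim (simp add: F_def)
  qed
  have ex: "\<exists>t. u < F t" if "u < 1" for u
    using order_tendstoD(1)[OF top that] eventually_happens' trivial_limit_at_top_linorder by blast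
  have "u \<in> range F" if u: "0 < u" "u < 1" for u
  proof -
    obtain b where b: "u < F b" using ex u by blast
    obtain a where "1 - u < F a" using ex[of "1 - u"] u by auto
    then have a: "F (- a) < u" by (simp add: F_minus)
    then have "- a \<le> b" using b strict_mono_less[OF strict_mono_F, of "- a" b] by linarith
    then show ?thesis
      using IVT'[of F "- a" u b] a b continuous_on_subset[OF continuous_on_F] by fastforce
  qed
  moreover have "0 < F t" for t using F_less_1[of "- t"] by (simp add: F_minus)
  ultimately show ?thesis
    using strict_mono_imp_inj_on[OF strict_mono_F] F_less_1 by (auto simp: bij_betw_def)
qed

section \<open>The equations for \<alpha> and \<beta>\<close>

text \<open>The linear equation eliminates \<alpha>. For \<beta> = 0 the remaining equation is
  empty, and it is the last clause of \<open>multipliers\<close> that forces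
  \<open>u = 1 / 2 = F 0\<close>.\<close>

lemma multipliers_iff: "multipliers u \<alpha> \<beta> \<longleftrightarrow> F (- \<beta>) = u \<and> \<alpha> = 1 - \<beta> * u"
proof (cases "\<beta> = 0")
  case True
  then show ?thesis by (auto simp: multipliers_def F_def)
next
  case False
  then have e: "exp \<beta> \<noteq> 1" by simp
  have half: "u \<noteq> 1 / 2 \<longrightarrow> \<beta> \<noteq> 0" using False by simp
  have "F (- \<beta>) = 1 / \<beta> - 1 / (exp \<beta> - 1)"
    using False e unfolding F_minus by (simp add: F_def field_simps)
  \<comment> \<open>The defect of the first equation factors; the cofactor of
    \<open>u - F (- \<beta>)\<close> is nonzero because \<beta> is.\<close>
  then have "(1 - \<beta> * u) + \<beta> - (1 - \<beta> * u) * exp \<beta> = \<beta> * (exp \<beta> - 1) * (u - F (- \<beta>))"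
    using False e by (simp add: field_simps)
  then have "F (- \<beta>) = u \<longleftrightarrow> (1 - \<beta> * u) + \<beta> = (1 - \<beta> * u) * exp \<beta>"
    using False e by (metis eq_iff_diff_eq_0 mult_eq_0_iff)
  moreover have "\<alpha> + \<beta> * u = 1 \<longleftrightarrow> \<alpha> = 1 - \<beta> * u" by linarith
  ultimately show ?thesis using half by (auto simp: multipliers_def)
qed

text \<open>Makes \<open>ln h\<close> and \<open>1 / h\<close> continuous on the unit interval.
  Since \<beta> and \<open>exp \<beta> - 1\<close> have the same sign, \<alpha> is positive; so is
  \<open>h 1 = \<alpha> * exp \<beta>\<close>, and \<open>h\<close> interpolates between its
  endpoint values.\<close>

lemma multipliers_pos:
  assumes "multipliers u \<alpha> \<beta>" "0 \<le> x" "x \<le> 1"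
  shows "0 < \<alpha> + \<beta> * x"
proof -
  have eq: "\<beta> = \<alpha> * (exp \<beta> - 1)"
    using assms(1) by (simp add: multipliers_def algebra_simps)
  have \<alpha>: "0 < \<alpha>"
  proof (cases "\<beta> = 0")
    case True then show ?thesis using assms(1) by (simp add: multipliers_def)
  next
    case False
    then show ?thesis using eq
      by (smt (verit) exp_gt_one exp_less_one_iff mult_nonneg_nonpos2 mult_nonpos_nonneg mult_nonpos_nonpos one_less_exp_iff)
  qed
  have "\<alpha> + \<beta> > 0" using assms(1) \<alpha> by (simp add: multipliers_def)
  then have "0 < (1 - x) * \<alpha> + x * (\<alpha> + \<beta>)"
    using \<alpha> assms(2,3) by (cases "x = 0") (auto intro!: add_nonneg_pos)
  then show ?thesis by (simp add: algebra_simps)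
qed

section \<open>The uniform distribution\<close>

lemma uniform01_eq: "uniform01 = restrict_space lborel {0..1}"
proof (rule measure_eqI)
  fix A assume "A \<in> sets uniform01"
  then have A: "A \<in> sets (restrict_space lborel {0..1::real})" by (simp add: uniform01_def)
  have top: "{0..1} \<in> sets (restrict_space lborel {0..1::real})"
    by (simp add: sets_restrict_space_iff)
  have "A \<subseteq> {0..1}" using sets.sets_into_space[OF A] by (simp add: space_restrict_space)
  then have "{0..1} \<inter> A = A" by blast
  then show "emeasure uniform01 A = emeasure (restrict_space lborel {0..1}) A"
    using A top by (simp add: uniform01_def emeasure_restrict_space divide_ennreal_def)
qed (simp add: uniform01_def)

lemma space_uniform01: "space uniform01 = {0..1}"
  by (simp add: uniform01_eq space_restrict_space)

lemma sets_uniform01: "sets uniform01 = sets (restrict_space borel {0..1})"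
  by (simp add: uniform01_eq sets_restrict_space)

lemma prob_space_uniform01: "prob_space uniform01"
  by (rule prob_spaceI) (simp add: uniform01_eq space_restrict_space emeasure_restrict_space)

text \<open>Continuous functions are bounded on a compact interval. The measure is kept general so
  that both the uniform distribution and the competitors \<mu> are covered.\<close>

lemma integrable_continuous_unit:
  fixes g :: "real \<Rightarrow> real"
  assumes "finite_measure M" "sets M = sets (restrict_space borel {0..1})"
    and "continuous_on {0..1} g"
  shows "integrable M g"
proof -
  have sp: "space M = {0..1}"
    using sets_eq_imp_space_eq[OF assms(2)] by (simp add: space_restrict_space)
  have "compact (g ` {0..1})"
    using assms(3) by (intro compact_continuous_image) auto
  then obtain B where B: "\<forall>x\<in>{0..1}. norm (g x) \<le> B"
    using compact_imp_bounded bounded_iff by (metis imageI)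
  have "g \<in> borel_measurable M"
    using borel_measurable_continuous_on_restrict[OF assms(3)]
    by (simp add: measurable_cong_sets[OF assms(2) refl])
  then show ?thesis
    using B sp by (intro finite_measure.integrable_const_bound[OF assms(1), of _ B]) auto
qed

lemmas integrable_uniform01 =
  integrable_continuous_unit[OF prob_space.finite_measure[OF prob_space_uniform01] sets_uniform01]

lemma integral_uniform01_FTC:
  fixes G g :: "real \<Rightarrow> real"
  assumes "continuous_on {0..1} g"
    and "\<And>x. 0 \<le> x \<Longrightarrow> x \<le> 1 \<Longrightarrow> (G has_real_derivative g x) (at x)"
  shows "(\<integral>x. g x \<partial>uniform01) = G 1 - G 0"
proof -
  have "(\<integral>x. g x \<partial>uniform01) = (\<integral>x. indicator {0..1} x *\<^sub>R g x \<partial>lborel)"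
    unfolding uniform01_eq by (subst integral_restrict_space) auto
  also have "\<dots> = G 1 - G 0"
    using assms by (intro integral_FTC_atLeastAtMost)
      (auto intro: has_vector_derivative_at_within simp: has_real_derivative_iff_has_vector_derivative)
  finally show ?thesis .
qed

text \<open>For nonzero \<beta> an antiderivative is \<open>(h ln h - h) / \<beta>\<close>; the
  equation \<open>h 1 = \<alpha> * exp \<beta>\<close> then simplifies the logarithm at the endpoint
  1.\<close>

lemma integral_ln_affine_uniform01:
  assumes "multipliers u \<alpha> \<beta>"
  shows "(\<integral>x. ln (\<alpha> + \<beta> * x) \<partial>uniform01) = \<beta> * (1 - u) + ln \<alpha>"
proof (cases "\<beta> = 0")
  case True
  then show ?thesis using assms by (simp add: multipliers_def)
next
  case False
  let ?h = "\<lambda>x. \<alpha> + \<beta> * x"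
  note pos = multipliers_pos[OF assms]
  have \<alpha>: "\<alpha> > 0" using pos[of 0] by simp
  have eq: "\<alpha> + \<beta> = \<alpha> * exp \<beta>" and one: "\<alpha> + \<beta> * u = 1"
    using assms by (auto simp: multipliers_def)
  have "(\<integral>x. ln (?h x) \<partial>uniform01) =
      (?h 1 * ln (?h 1) - ?h 1) / \<beta> - (?h 0 * ln (?h 0) - ?h 0) / \<beta>"
  proof (rule integral_uniform01_FTC)
    show "continuous_on {0..1} (\<lambda>x. ln (?h x))"
      using pos by (intro continuous_intros) (auto simp: less_le)
    fix x :: real assume "0 \<le> x" "x \<le> 1"
    then have "?h x > 0" by (rule pos)
    then have "((\<lambda>x. (?h x * ln (?h x) - ?h x) / \<beta>) has_real_derivative
        (\<beta> * ln (?h x) + ?h x * (\<beta> / ?h x) - \<beta>) / \<beta>) (at x)"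
      using False by (auto intro!: derivative_eq_intros)
    then show "((\<lambda>x. (?h x * ln (?h x) - ?h x) / \<beta>) has_real_derivative ln (?h x)) (at x)"
      using False \<open>?h x > 0\<close> by simp
  qed
  also have "ln (?h 1) = ln \<alpha> + \<beta>" using \<alpha> by (simp add: eq ln_mult)
  also have "(?h 1 * (ln \<alpha> + \<beta>) - ?h 1) / \<beta> - (?h 0 * ln (?h 0) - ?h 0) / \<beta> =
      ln \<alpha> + (\<alpha> + \<beta>) - 1"
    using False by (simp add: field_simps)
  also have "\<dots> = \<beta> * (1 - u) + ln \<alpha>" using one by (simp add: algebra_simps)
  finally show ?thesis .
qed

text \<open>Total mass and mean of the measure with density \<open>1 / h\<close>.\<close>

lemma integral_inverse_affine_uniform01:
  assumes "multipliers u \<alpha> \<beta>"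
  shows "(\<integral>x. 1 / (\<alpha> + \<beta> * x) \<partial>uniform01) = 1"
    and "(\<integral>x. x / (\<alpha> + \<beta> * x) \<partial>uniform01) = u"
proof -
  let ?h = "\<lambda>x. \<alpha> + \<beta> * x"
  note pos = multipliers_pos[OF assms]
  have \<alpha>: "\<alpha> > 0" using pos[of 0] by simp
  have eq: "\<alpha> + \<beta> = \<alpha> * exp \<beta>" and one: "\<alpha> + \<beta> * u = 1" and half: "\<beta> = 0 \<Longrightarrow> u = 1 / 2"
    using assms by (auto simp: multipliers_def)
  have cont: "continuous_on {0..1} (\<lambda>x. 1 / ?h x)" "continuous_on {0..1} (\<lambda>x. x / ?h x)"
    using pos by (intro continuous_intros; force)+
  show *: "(\<integral>x. 1 / ?h x \<partial>uniform01) = 1"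
  proof (cases "\<beta> = 0")
    case True
    then show ?thesis
      using one prob_space.prob_space[OF prob_space_uniform01] by simp
  next
    case False
    have "(\<integral>x. 1 / ?h x \<partial>uniform01) = ln (?h 1) / \<beta> - ln (?h 0) / \<beta>"
    proof (rule integral_uniform01_FTC[OF cont(1)])
      fix x :: real assume "0 \<le> x" "x \<le> 1"
      then have "?h x > 0" by (rule pos)
      then have "((\<lambda>x. ln (?h x) / \<beta>) has_real_derivative (\<beta> / ?h x) / \<beta>) (at x)"
        using False by (auto intro!: derivative_eq_intros)
      then show "((\<lambda>x. ln (?h x) / \<beta>) has_real_derivative 1 / ?h x) (at x)"
        using False by simp
    qed
    also have "ln (?h 1) = ln \<alpha> + \<beta>" using \<alpha> by (simp add: eq ln_mult)
    finally show ?thesis using False by (simp add: field_simps)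
  qed
  show "(\<integral>x. x / ?h x \<partial>uniform01) = u"
  proof (cases "\<beta> = 0")
    \<comment> \<open>Here \<open>h\<close> is constantly 1, and the nondegeneracy clause supplies
      \<open>u = 1 / 2\<close>, the mean of the uniform distribution.\<close>
    case True
    have "(\<integral>x. x \<partial>uniform01) = 1\<^sup>2 / 2 - 0\<^sup>2 / 2"
      by (rule integral_uniform01_FTC) (auto intro!: continuous_intros derivative_eq_intros)
    then show ?thesis using one half True by simp
  next
    case False
    \<comment> \<open>Integrating \<open>h / h = 1\<close> expresses the mean through the total
      mass, already known to be 1; comparison with \<open>\<alpha> + \<beta> * u = 1\<close> gives
      the claim.\<close>
    have "\<alpha> * (\<integral>x. 1 / ?h x \<partial>uniform01) + \<beta> * (\<integral>x. x / ?h x \<partial>uniform01) =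
        (\<integral>x. \<alpha> * (1 / ?h x) + \<beta> * (x / ?h x) \<partial>uniform01)"
      using integrable_uniform01[OF cont(1)] integrable_uniform01[OF cont(2)]
      by (simp del: times_divide_eq_right)
    also have "\<dots> = (\<integral>x. 1 \<partial>uniform01)"
    proof (rule Bochner_Integration.integral_cong[OF refl])
      fix x assume "x \<in> space uniform01"
      then have "?h x > 0" using pos by (simp add: space_uniform01)
      then show "\<alpha> * (1 / ?h x) + \<beta> * (x / ?h x) = 1"
        by (simp add: add_divide_distrib[symmetric])
    qed
    also have "\<dots> = 1" using prob_space.prob_space[OF prob_space_uniform01] by simp
    finally have "\<beta> * (\<integral>x. x / ?h x \<partial>uniform01) = \<beta> * u"
      unfolding * using one by linarith
    then show ?thesis using False by simp
  qed
qed

section \<open>The variational problem\<close>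

lemma (in prob_space) expectation_le_ln_expectation_exp:
  fixes f :: "'a \<Rightarrow> real"
  assumes "integrable M f" "integrable M (\<lambda>x. exp (f x))"
  shows "expectation f \<le> ln (expectation (\<lambda>x. exp (f x)))"
proof -
  have "exp (expectation f) \<le> expectation (\<lambda>x. exp (f x))"
    using jensens_inequality[of f UNIV 0 0 exp] assms exp_convex by auto
  then show ?thesis
    by (metis exp_gt_zero less_le_trans ln_exp ln_le_cancel_iff)
qed

lemma relative_entropy_ge:
  assumes "multipliers u \<alpha> \<beta>" "\<mu> \<in> prob_measures {0..1}" "(\<integral>x. x \<partial>\<mu>) = u"
  shows "ereal (\<integral>x. ln (\<alpha> + \<beta> * x) \<partial>\<nu>) \<le> relative_entropy {0..1} \<nu> \<mu>"
proof -
  note pos = multipliers_pos[OF assms(1)]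
  interpret prob_space \<mu> using assms(2) by (simp add: prob_measures_def)
  have sets: "sets \<mu> = sets (restrict_space borel {0..1})"
    using assms(2) by (simp add: prob_measures_def)
  have sp: "space \<mu> = {0..1}"
    using sets_eq_imp_space_eq[OF sets] by (simp add: space_restrict_space)
  have int: "integrable \<mu> (\<lambda>x. x)"
    by (rule integrable_continuous_unit[OF finite_measure_axioms sets]) (rule continuous_on_id)
  have "(\<integral>x. exp (ln (\<alpha> + \<beta> * x)) \<partial>\<mu>) = (\<integral>x. \<alpha> + \<beta> * x \<partial>\<mu>)"
    using pos by (intro Bochner_Integration.integral_cong) (auto simp: sp)
  also have "\<dots> = \<alpha> + \<beta> * u" using int assms(3) prob_space by simp
  also have "\<dots> = 1" using assms(1) by (simp add: multipliers_def)
  finally have 1: "(\<integral>x. exp (ln (\<alpha> + \<beta> * x)) \<partial>\<mu>) = 1" .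
  have "continuous_on {0..1} (\<lambda>x. ln (\<alpha> + \<beta> * x))"
    using pos by (intro continuous_intros) (auto simp: less_le)
  then show ?thesis
    unfolding relative_entropy_def using 1
    by (intro SUP_upper2[where i = "\<lambda>x. ln (\<alpha> + \<beta> * x)"]) auto
qed

text \<open>The upper bound: one admissible measure at which no test function exceeds the value
  given by \<open>ln h\<close>.\<close>

lemma relative_entropy_minimizer:
  assumes "multipliers u \<alpha> \<beta>"
  defines "\<mu> \<equiv> density uniform01 (\<lambda>x. ennreal (1 / (\<alpha> + \<beta> * x)))"
  shows "\<mu> \<in> prob_measures {0..1}" "(\<integral>x. x \<partial>\<mu>) = u"
    and "relative_entropy {0..1} uniform01 \<mu> \<le> ereal (\<integral>x. ln (\<alpha> + \<beta> * x) \<partial>uniform01)"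
proof -
  let ?h = "\<lambda>x. \<alpha> + \<beta> * x"
  note pos = multipliers_pos[OF assms(1)]
  interpret U: prob_space uniform01 by (rule prob_space_uniform01)
  have cont: "continuous_on {0..1} (\<lambda>x. 1 / ?h x)"
    using pos by (intro continuous_intros; force)
  note int = integrable_uniform01[OF cont]
  have nn: "AE x in uniform01. 0 \<le> 1 / ?h x"
    using pos by (intro AE_I2) (auto simp: space_uniform01 less_imp_le)
  have meas: "g \<in> borel_measurable uniform01" if "continuous_on {0..1} g" for g :: "real \<Rightarrow> real"
    using integrable_uniform01[OF that] by (rule borel_measurable_integrable)
  have dens: "(\<integral>x. g x \<partial>\<mu>) = (\<integral>x. g x / ?h x \<partial>uniform01)"
    if "continuous_on {0..1} g" for g :: "real \<Rightarrow> real"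
    unfolding \<mu>_def
    using integral_density[OF meas[OF that] meas[OF cont] nn] by simp
  have "emeasure \<mu> (space \<mu>) = (\<integral>\<^sup>+x. ennreal (1 / ?h x) \<partial>uniform01)"
    unfolding \<mu>_def using meas[OF cont]
    by (subst emeasure_density) (auto intro!: nn_integral_cong)
  also have "\<dots> = 1"
    using nn_integral_eq_integral[OF int nn] integral_inverse_affine_uniform01(1)[OF assms(1)]
    by simp
  finally have "prob_space \<mu>" by (rule prob_spaceI)
  then show "\<mu> \<in> prob_measures {0..1}"
    by (simp add: prob_measures_def \<mu>_def sets_uniform01)
  show "(\<integral>x. x \<partial>\<mu>) = u"
    using dens[OF continuous_on_id] integral_inverse_affine_uniform01(2)[OF assms(1)] by simp
  have lnh: "continuous_on {0..1} (\<lambda>x. ln (?h x))"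
    using pos by (intro continuous_intros) (auto simp: less_le)
  have "(\<integral>x. g x \<partial>uniform01) - ln (\<integral>x. exp (g x) \<partial>\<mu>) \<le> (\<integral>x. ln (?h x) \<partial>uniform01)"
    if g: "continuous_on {0..1} g" for g :: "real \<Rightarrow> real"
  proof -
    have "(\<integral>x. g x \<partial>uniform01) - (\<integral>x. ln (?h x) \<partial>uniform01) = (\<integral>x. g x - ln (?h x) \<partial>uniform01)"
      using integrable_uniform01[OF g] integrable_uniform01[OF lnh] by simp
    \<comment> \<open>Jensen is applied to \<open>g - ln h\<close> under the uniform distribution;
      the factor \<open>exp (- ln h) = 1 / h\<close> is the density that turns the right-hand
      integral into one against \<mu>.\<close>
    also have "\<dots> \<le> ln (\<integral>x. exp (g x - ln (?h x)) \<partial>uniform01)"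
      using g lnh
      by (intro U.expectation_le_ln_expectation_exp integrable_uniform01
          continuous_on_exp continuous_on_diff)
    also have "(\<integral>x. exp (g x - ln (?h x)) \<partial>uniform01) = (\<integral>x. exp (g x) / ?h x \<partial>uniform01)"
      using pos by (intro Bochner_Integration.integral_cong) (auto simp: space_uniform01 exp_diff)
    also have "\<dots> = (\<integral>x. exp (g x) \<partial>\<mu>)"
      using g by (intro dens[symmetric] continuous_intros)
    finally show ?thesis by simp
  qed
  then show "relative_entropy {0..1} uniform01 \<mu> \<le> ereal (\<integral>x. ln (?h x) \<partial>uniform01)"
    unfolding relative_entropy_def by (intro SUP_least) auto
qed

lemma I1_uniform01:
  assumes "multipliers u \<alpha> \<beta>"
  shows "I1 u uniform01 = ereal (\<integral>x. ln (\<alpha> + \<beta> * x) \<partial>uniform01)"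
  unfolding I1_def
proof (rule antisym)
  show "(INF \<mu>\<in>{\<mu> \<in> prob_measures {0..1}. (\<integral>x. x \<partial>\<mu>) = u}. relative_entropy {0..1} uniform01 \<mu>)
      \<le> ereal (\<integral>x. ln (\<alpha> + \<beta> * x) \<partial>uniform01)"
    using relative_entropy_minimizer[OF assms] by (intro INF_lower2) auto
qed (auto intro!: INF_greatest relative_entropy_ge[OF assms])

theorem theorem4p2:
  fixes u :: real
  assumes "0 < u" and "u < 1"
  shows "bij_betw F UNIV {0<..<1} \<and>
    (\<exists>!(\<alpha>, \<beta>). multipliers u \<alpha> \<beta>) \<and>
    (\<forall>\<alpha> \<beta>. multipliers u \<alpha> \<beta> \<longrightarrow>
       I1 u uniform01 = ereal (\<integral>x. ln (\<alpha> + \<beta> * x) \<partial>uniform01) \<and>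
       (\<integral>x. ln (\<alpha> + \<beta> * x) \<partial>uniform01) = inv F u * (u - 1) + ln (1 + inv F u * u))"
proof -
  define t where "t = inv F u"
  \<comment> \<open>The bounds on \<open>u\<close> place it in the range of \<open>F\<close>, so
    \<open>inv F u\<close> is a genuine preimage.\<close>
  have inj: "inj F" and "u \<in> range F"
    using bij_betw_F assms by (auto simp: bij_betw_def)
  then have F_eq: "F s = u \<longleftrightarrow> s = t" for s
    unfolding t_def by (metis f_inv_into_f inv_f_f)
  \<comment> \<open>With \<open>t = inv F u\<close> the multipliers are explicit, which yields
    existence, uniqueness and the closed form together.\<close>
  have iff: "multipliers u \<alpha> \<beta> \<longleftrightarrow> \<alpha> = 1 + t * u \<and> \<beta> = - t" for \<alpha> \<beta>
    by (auto simp: multipliers_iff F_eq)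
  have "\<exists>!(\<alpha>, \<beta>). multipliers u \<alpha> \<beta>"
    by (rule ex1I[of _ "(1 + t * u, - t)"]) (auto simp: iff)
  moreover have "(\<integral>x. ln (\<alpha> + \<beta> * x) \<partial>uniform01) = t * (u - 1) + ln (1 + t * u)"
    if "multipliers u \<alpha> \<beta>" for \<alpha> \<beta>
    using integral_ln_affine_uniform01[OF that] that by (simp add: iff algebra_simps)
  ultimately show ?thesis
    using bij_betw_F I1_uniform01 unfolding t_def by blast
qed

end
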